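(* Let $\Omega=\{u\in\mathbb{Q}^{\omega_1}: 0\leq u_\alpha\leq 1\text{ for all }\alpha<\omega_1,\text{ and }u_\gamma\leq 2u_\beta\text{ whenever }0<\gamma<\beta<\omega_1\}$, and let $G$ be the $\mathbb{Q}$-vector sublattice of $\mathbb{Q}^{\Omega}$ (with pointwise operations) generated by the projections $p_\alpha\colon\Omega\to\mathbb{Q}$, $u\mapsto u_\alpha$ ($\alpha<\omega_1$), together with the constant function $p_{\omega_1}\colon u\mapsto 1$. Then $G$ is Archimedean with strong unit. Furthermore, no deviation on the lattice $\operatorname{Id}_c G$ of principal $\ell$-ideals of $G$ is either left isotone or right antitone. In fact, for every deviation $\smallsetminus$ on $\operatorname{Id}_c G$ there are ordinals $\alpha,\beta,\alpha',\beta'$ with $0<\alpha<\beta<\omega_1$ and $0<\alpha'<\beta'<\omega_1$ such that $\langle p_0\rangle\smallsetminus\langle p_\beta\rangle\not\leq\langle p_0\rangle\smallsetminus\langle p_\alpha\rangle$ and $\langle p_{\alpha'}\rangle\smallsetminus\langle p_0\rangle\not\leq\langle p_{\beta'}\rangle\smallsetminus\langle p_0\rangle$.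
   Context: For $a\in G$, $\langle a\rangle=\{x\in G: -n|a|\leq x\leq n|a|\text{ for some }n\in\omega\}$ with $|a|=a\vee(-a)$; $\operatorname{Id}_c G$ is the set of all such $\langle a\rangle$, ordered by inclusion (a distributive lattice with $0$). A deviation on a distributive lattice $D$ with $0$ is a binary operation $\smallsetminus$ with $x\leq y\vee(x\smallsetminus y)$ and $(x\smallsetminus y)\wedge(y\smallsetminus x)=0$ for all $x,y$. It is left isotone if $x\leq x'$ implies $x\smallsetminus y\leq x'\smallsetminus y$, and right antitone if $y\leq y'$ implies $x\smallsetminus y'\leq x\smallsetminus y$. *)

theory Defs
  imports
    Complex_Main
    "HOL-Algebra.Lattice"
    "HOL-Library.Function_Algebras"
    "HOL-Library.Countable_Set_Type"
begin

hide_const (open) Lattice.sup Lattice.inf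

unbundle cardinal_syntax


section \<open>The ordinal \<open>\<omega>\<^sub>1\<close>\<close>

text \<open>
  \<open>cardSuc natLeq\<close> is a well-order of cardinality \<open>\<aleph>\<^sub>1\<close> all of whose proper initial
  segments are countable; the type of its elements represents the set of all ordinals
  below \<open>\<omega>\<^sub>1\<close>.
\<close>

lemma natLeq_lt_cardSuc: "natLeq <o cardSuc natLeq"
  by (rule cardSuc_greater[OF natLeq_Card_order])

lemma Well_order_cardSuc_natLeq: "Well_order (cardSuc natLeq)"
  using cardSuc_Card_order[OF natLeq_Card_order] by (simp add: card_order_on_def)

lemma uncountable_Field_cardSuc_natLeq: "\<not> countable (Field (cardSuc natLeq))"
proof
  assume "countable (Field (cardSuc natLeq))"
  then have "|Field (cardSuc natLeq)| \<le>o natLeq"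
    by (simp add: countable_card_le_natLeq)
  moreover have "|Field (cardSuc natLeq)| =o cardSuc natLeq"
    by (rule card_of_Field_ordIso[OF cardSuc_Card_order[OF natLeq_Card_order]])
  ultimately have "cardSuc natLeq \<le>o natLeq"
    using ordIso_ordLeq_trans ordIso_symmetric by blast
  then show False
    using natLeq_lt_cardSuc not_ordLess_ordLeq by blast
qed

typedef omega1 = "Field (cardSuc natLeq)"
proof -
  have "Field (cardSuc natLeq) \<noteq> {}"
    using uncountable_Field_cardSuc_natLeq by force
  then show ?thesis by blast
qed

instantiation omega1 :: linorder
begin

definition less_eq_omega1 :: "omega1 \<Rightarrow> omega1 \<Rightarrow> bool" where
  "\<alpha> \<le> \<beta> \<longleftrightarrow> (Rep_omega1 \<alpha>, Rep_omega1 \<beta>) \<in> cardSuc natLeq"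

definition less_omega1 :: "omega1 \<Rightarrow> omega1 \<Rightarrow> bool" where
  "\<alpha> < \<beta> \<longleftrightarrow> \<alpha> \<le> \<beta> \<and> \<not> \<beta> \<le> (\<alpha>::omega1)"

instance
proof
  note wo = Well_order_cardSuc_natLeq[unfolded well_order_on_def linear_order_on_def
      partial_order_on_def preorder_on_def]
  fix \<alpha> \<beta> \<gamma> :: omega1
  show "\<alpha> < \<beta> \<longleftrightarrow> \<alpha> \<le> \<beta> \<and> \<not> \<beta> \<le> \<alpha>"
    by (rule less_omega1_def)
  show "\<alpha> \<le> \<alpha>"
    using wo Rep_omega1[of \<alpha>] by (auto simp: less_eq_omega1_def refl_on_def)
  show "\<alpha> \<le> \<gamma>" if "\<alpha> \<le> \<beta>" "\<beta> \<le> \<gamma>"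
    using wo that unfolding less_eq_omega1_def by (meson transD)
  show "\<alpha> = \<beta>" if "\<alpha> \<le> \<beta>" "\<beta> \<le> \<alpha>"
    using wo that Rep_omega1_inject unfolding less_eq_omega1_def by (meson antisymD)
  show "\<alpha> \<le> \<beta> \<or> \<beta> \<le> \<alpha>"
    using wo Rep_omega1[of \<alpha>] Rep_omega1[of \<beta>]
    unfolding less_eq_omega1_def total_on_def refl_on_def by metis
qed

end

instance omega1 :: wellorder
proof (rule wf_wellorderI)
  have "wf (cardSuc natLeq - Id)"
    using Well_order_cardSuc_natLeq by (simp add: well_order_on_def)
  then have "wf (inv_image (cardSuc natLeq - Id) Rep_omega1)"
    by (rule wf_inv_image)
  moreover have "{(\<alpha>, \<beta>::omega1). \<alpha> < \<beta>} \<subseteq> inv_image (cardSuc natLeq - Id) Rep_omega1"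
    by (auto simp: less_omega1_def less_eq_omega1_def inv_image_def)
  ultimately show "wf {(\<alpha>, \<beta>::omega1). \<alpha> < \<beta>}"
    by (rule wf_subset)
qed intro_classes

instantiation omega1 :: zero
begin

definition zero_omega1 :: omega1 where
  "(0::omega1) = (LEAST \<alpha>. True)"

instance ..

end

lemma omega1_zero_le: "0 \<le> (\<alpha>::omega1)"
  unfolding zero_omega1_def by (rule Least_le) simp

lemma uncountable_omega1: "uncountable (UNIV :: omega1 set)"
proof
  assume "countable (UNIV :: omega1 set)"
  then have "countable (range Rep_omega1)"
    by (rule countable_image)
  then show False
    using uncountable_Field_cardSuc_natLeq
    by (simp add: type_definition.Rep_range[OF type_definition_omega1])
qed

lemma countable_below_omega1: "countable {..<\<alpha>::omega1}"
proof -
  let ?r = "cardSuc natLeq"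
  have "|underS ?r (Rep_omega1 \<alpha>)| <o ?r"
    by (rule card_of_underS[OF cardSuc_Card_order[OF natLeq_Card_order] Rep_omega1])
  then have "|underS ?r (Rep_omega1 \<alpha>)| \<le>o natLeq"
    using cardSuc_ordLeq_ordLess[OF natLeq_Card_order card_of_Card_order] by blast
  then have "countable (underS ?r (Rep_omega1 \<alpha>))"
    by (simp add: countable_card_le_natLeq)
  moreover have "Rep_omega1 ` {..<\<alpha>} \<subseteq> underS ?r (Rep_omega1 \<alpha>)"
    by (auto simp: underS_def less_omega1_def less_eq_omega1_def)
  ultimately have "countable (Rep_omega1 ` {..<\<alpha>})"
    by (rule countable_subset[rotated])
  then show ?thesis
    by (rule countable_image_inj_on) (simp add: inj_on_def Rep_omega1_inject)
qed


section \<open>Vector lattices of rational-valued functions\<close>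

definition qscale :: "rat \<Rightarrow> ('x \<Rightarrow> rat) \<Rightarrow> 'x \<Rightarrow> rat" where
  "qscale q f = (\<lambda>x. q * f x)"

global_interpretation qfun: vector_space qscale
  by unfold_locales (auto simp: qscale_def fun_eq_iff algebra_simps)

definition vector_sublattice :: "('x \<Rightarrow> rat) set \<Rightarrow> bool" where
  "vector_sublattice V \<longleftrightarrow>
     qfun.subspace V \<and> (\<forall>f\<in>V. \<forall>g\<in>V. sup f g \<in> V \<and> inf f g \<in> V)"

definition generated_vector_sublattice :: "('x \<Rightarrow> rat) set \<Rightarrow> ('x \<Rightarrow> rat) set" where
  "generated_vector_sublattice S = vector_sublattice hull S"

lemma vector_sublattice_generated: "vector_sublattice (generated_vector_sublattice S)"
  unfolding generated_vector_sublattice_def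
  by (rule hull_in) (auto simp: vector_sublattice_def qfun.subspace_def)

text \<open>The notions below concern an \<open>\<ell>\<close>-subgroup \<open>G\<close> of a power of \<open>\<rat>\<close>;
  \<open>qscale (of_nat n) a\<close> is the multiple \<open>n a\<close>.\<close>

definition archimedean :: "('x \<Rightarrow> rat) set \<Rightarrow> bool" where
  "archimedean G \<longleftrightarrow>
     (\<forall>a\<in>G. \<forall>b\<in>G. (\<forall>n::nat. qscale (of_nat n) a \<le> b) \<longrightarrow> a \<le> 0)"

definition strong_unit :: "('x \<Rightarrow> rat) set \<Rightarrow> ('x \<Rightarrow> rat) \<Rightarrow> bool" where
  "strong_unit G u \<longleftrightarrow>
     u \<in> G \<and> 0 \<le> u \<and> (\<forall>a\<in>G. \<exists>n::nat. a \<le> qscale (of_nat n) u)"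

definition labs :: "('x \<Rightarrow> rat) \<Rightarrow> 'x \<Rightarrow> rat" where
  "labs a = sup a (- a)"

definition principal_ideal :: "('x \<Rightarrow> rat) set \<Rightarrow> ('x \<Rightarrow> rat) \<Rightarrow> ('x \<Rightarrow> rat) set" where
  "principal_ideal G a =
     {x \<in> G. \<exists>n::nat. - qscale (of_nat n) (labs a) \<le> x \<and> x \<le> qscale (of_nat n) (labs a)}"

definition Idc :: "('x \<Rightarrow> rat) set \<Rightarrow> ('x \<Rightarrow> rat) set gorder" where
  "Idc G = \<lparr>carrier = principal_ideal G ` G, eq = (=), le = (\<subseteq>)\<rparr>"


section \<open>Deviations\<close>

definition deviation :: "('a, 'b) gorder_scheme \<Rightarrow> ('a \<Rightarrow> 'a \<Rightarrow> 'a) \<Rightarrow> bool" where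
  "deviation D d \<longleftrightarrow>
     d \<in> carrier D \<rightarrow> carrier D \<rightarrow> carrier D \<and>
     (\<forall>x\<in>carrier D. \<forall>y\<in>carrier D.
        x \<sqsubseteq>\<^bsub>D\<^esub> y \<squnion>\<^bsub>D\<^esub> d x y \<and> d x y \<sqinter>\<^bsub>D\<^esub> d y x = \<bottom>\<^bsub>D\<^esub>)"

definition left_isotone :: "('a, 'b) gorder_scheme \<Rightarrow> ('a \<Rightarrow> 'a \<Rightarrow> 'a) \<Rightarrow> bool" where
  "left_isotone D d \<longleftrightarrow>
     (\<forall>x\<in>carrier D. \<forall>x'\<in>carrier D. \<forall>y\<in>carrier D. x \<sqsubseteq>\<^bsub>D\<^esub> x' \<longrightarrow> d x y \<sqsubseteq>\<^bsub>D\<^esub> d x' y)"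

definition right_antitone :: "('a, 'b) gorder_scheme \<Rightarrow> ('a \<Rightarrow> 'a \<Rightarrow> 'a) \<Rightarrow> bool" where
  "right_antitone D d \<longleftrightarrow>
     (\<forall>x\<in>carrier D. \<forall>y\<in>carrier D. \<forall>y'\<in>carrier D. y \<sqsubseteq>\<^bsub>D\<^esub> y' \<longrightarrow> d x y' \<sqsubseteq>\<^bsub>D\<^esub> d x y)"


subsection \<open>\<open>Idc G\<close> is a distributive lattice with zero\<close>

text \<open>In particular the join, meet and bottom used in the definition of a deviation exist.\<close>

context
  fixes G :: "('x \<Rightarrow> rat) set"
  assumes G: "vector_sublattice G"
begin

lemma mem_principal_ideal:
  "x \<in> principal_ideal G a \<longleftrightarrow> x \<in> G \<and> (\<exists>n::nat. \<forall>t. \<bar>x t\<bar> \<le> of_nat n * \<bar>a t\<bar>)"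
proof -
  have eq: "labs a t = \<bar>a t\<bar>" for t
    by (simp add: labs_def sup_rat_def)
  show ?thesis
    by (auto simp: principal_ideal_def eq le_fun_def qscale_def abs_le_iff minus_le_iff)
qed

lemma labs_closed: "a \<in> G \<Longrightarrow> labs a \<in> G"
  using G qfun.subspace_neg by (auto simp: vector_sublattice_def labs_def)

lemma labs_apply: "labs a t = \<bar>a t\<bar>"
  by (simp add: labs_def sup_rat_def)

lemma principal_ideal_subset_iff:
  assumes "a \<in> G"
  shows "principal_ideal G a \<subseteq> principal_ideal G b \<longleftrightarrow>
    (\<exists>n::nat. \<forall>t. \<bar>a t\<bar> \<le> of_nat n * \<bar>b t\<bar>)"
proof
  assume "principal_ideal G a \<subseteq> principal_ideal G b"
  moreover have "a \<in> principal_ideal G a"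
    using assms by (auto simp: mem_principal_ideal intro!: exI[of _ 1])
  ultimately have "a \<in> principal_ideal G b"
    by blast
  then show "\<exists>n::nat. \<forall>t. \<bar>a t\<bar> \<le> of_nat n * \<bar>b t\<bar>"
    by (simp add: mem_principal_ideal)
next
  assume "\<exists>n::nat. \<forall>t. \<bar>a t\<bar> \<le> of_nat n * \<bar>b t\<bar>"
  then obtain n :: nat where n: "\<And>t. \<bar>a t\<bar> \<le> of_nat n * \<bar>b t\<bar>" by blast
  show "principal_ideal G a \<subseteq> principal_ideal G b"
  proof
    fix x assume "x \<in> principal_ideal G a"
    then obtain m :: nat where x: "x \<in> G" and m: "\<And>t. \<bar>x t\<bar> \<le> of_nat m * \<bar>a t\<bar>"
      by (auto simp: mem_principal_ideal)
    have "\<bar>x t\<bar> \<le> of_nat (m * n) * \<bar>b t\<bar>" for t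
    proof -
      have "\<bar>x t\<bar> \<le> of_nat m * \<bar>a t\<bar>" by (rule m)
      also have "\<dots> \<le> of_nat m * (of_nat n * \<bar>b t\<bar>)" by (intro mult_left_mono n) simp
      finally show ?thesis by (simp add: mult.assoc)
    qed
    with x show "x \<in> principal_ideal G b"
      unfolding mem_principal_ideal by blast
  qed
qed

lemma partial_order_Idc: "partial_order (Idc G)"
  by unfold_locales (auto simp: Idc_def)

lemma least_Idc_join:
  assumes "a \<in> G" "b \<in> G"
  shows "least (Idc G) (principal_ideal G (sup (labs a) (labs b)))
           (Upper (Idc G) {principal_ideal G a, principal_ideal G b})"
proof -
  let ?j = "sup (labs a) (labs b)"
  have j: "?j \<in> G"
    using G assms labs_closed by (auto simp: vector_sublattice_def)
  have jt: "\<bar>?j t\<bar> = max \<bar>a t\<bar> \<bar>b t\<bar>" for t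
    by (simp add: labs_apply sup_rat_def)
  have ub: "principal_ideal G a \<subseteq> principal_ideal G ?j" "principal_ideal G b \<subseteq> principal_ideal G ?j"
    using assms by (auto simp: principal_ideal_subset_iff jt simp del: sup_apply intro!: exI[of _ 1])
  have lub: "principal_ideal G ?j \<subseteq> principal_ideal G c"
    if c: "principal_ideal G a \<subseteq> principal_ideal G c"
      "principal_ideal G b \<subseteq> principal_ideal G c" for c
  proof -
    obtain m n :: nat where m: "\<And>t. \<bar>a t\<bar> \<le> of_nat m * \<bar>c t\<bar>"
      and n: "\<And>t. \<bar>b t\<bar> \<le> of_nat n * \<bar>c t\<bar>"
      using c assms by (auto simp: principal_ideal_subset_iff)
    have "\<bar>?j t\<bar> \<le> of_nat (m + n) * \<bar>c t\<bar>" for t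
      using add_mono[OF m[of t], of 0 "of_nat n * \<bar>c t\<bar>"]
        add_mono[OF _ n[of t], of 0 "of_nat m * \<bar>c t\<bar>"]
      unfolding jt by (simp add: distrib_right)
    then show ?thesis
      unfolding principal_ideal_subset_iff[OF j] by blast
  qed
  show ?thesis
    unfolding least_def
  proof (intro conjI ballI)
    show "Upper (Idc G) {principal_ideal G a, principal_ideal G b} \<subseteq> carrier (Idc G)"
      by (simp add: Upper_def)
    show "principal_ideal G ?j \<in> Upper (Idc G) {principal_ideal G a, principal_ideal G b}"
      using j ub unfolding Upper_def Idc_def by simp blast
    fix K assume K: "K \<in> Upper (Idc G) {principal_ideal G a, principal_ideal G b}"
    then obtain c where c: "K = principal_ideal G c"
      by (auto simp: Upper_def Idc_def)
    have ab: "{principal_ideal G a, principal_ideal G b} \<subseteq> carrier (Idc G)"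
      using assms by (simp add: Idc_def)
    have "principal_ideal G a \<subseteq> principal_ideal G c" "principal_ideal G b \<subseteq> principal_ideal G c"
      using Upper_memD[OF K _ ab] by (simp_all add: c Idc_def)
    then show "principal_ideal G ?j \<sqsubseteq>\<^bsub>Idc G\<^esub> K"
      using lub by (simp add: c Idc_def)
  qed
qed

lemma principal_ideal_inf:
  assumes "a \<in> G" "b \<in> G"
  shows "principal_ideal G (inf (labs a) (labs b)) = principal_ideal G a \<inter> principal_ideal G b"
proof -
  let ?m = "inf (labs a) (labs b)"
  have mt: "\<bar>?m t\<bar> = min \<bar>a t\<bar> \<bar>b t\<bar>" for t
    by (simp add: labs_apply inf_rat_def)
  have m: "?m \<in> G"
    using G assms labs_closed by (auto simp: vector_sublattice_def)
  have "principal_ideal G ?m \<subseteq> principal_ideal G a" "principal_ideal G ?m \<subseteq> principal_ideal G b"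
    using m by (auto simp: principal_ideal_subset_iff mt simp del: inf_apply intro!: exI[of _ 1])
  moreover have "x \<in> principal_ideal G ?m"
    if xa: "x \<in> principal_ideal G a" and xb: "x \<in> principal_ideal G b" for x
  proof -
    obtain k l :: nat where x: "x \<in> G" and k: "\<And>t. \<bar>x t\<bar> \<le> of_nat k * \<bar>a t\<bar>"
      and l: "\<And>t. \<bar>x t\<bar> \<le> of_nat l * \<bar>b t\<bar>"
      using xa xb by (auto simp: mem_principal_ideal)
    have "\<bar>x t\<bar> \<le> of_nat (k + l) * \<bar>?m t\<bar>" for t
    proof (cases "\<bar>a t\<bar> \<le> \<bar>b t\<bar>")
      case True
      then show ?thesis
        using add_mono[OF k[of t], of 0 "of_nat l * \<bar>a t\<bar>"] unfolding mt
        by (simp add: distrib_right)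
    next
      case False
      then show ?thesis
        using add_mono[OF _ l[of t], of 0 "of_nat k * \<bar>b t\<bar>"] unfolding mt
        by (simp add: distrib_right)
    qed
    with x show ?thesis unfolding mem_principal_ideal by blast
  qed
  ultimately show ?thesis by blast
qed

lemma greatest_Idc_meet:
  assumes "a \<in> G" "b \<in> G"
  shows "greatest (Idc G) (principal_ideal G a \<inter> principal_ideal G b)
           (Lower (Idc G) {principal_ideal G a, principal_ideal G b})"
proof -
  have "inf (labs a) (labs b) \<in> G"
    using G assms labs_closed by (auto simp: vector_sublattice_def)
  then have "principal_ideal G a \<inter> principal_ideal G b \<in> carrier (Idc G)"
    unfolding principal_ideal_inf[OF assms, symmetric] by (simp add: Idc_def)
  then show ?thesis
    using assms by (auto simp: greatest_def Lower_def Idc_def)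
qed

lemma lattice_Idc: "lattice (Idc G)"
proof -
  interpret partial_order "Idc G" by (rule partial_order_Idc)
  show ?thesis
  proof
    fix I J assume "I \<in> carrier (Idc G)" "J \<in> carrier (Idc G)"
    then obtain a b where ab: "a \<in> G" "b \<in> G" "I = principal_ideal G a" "J = principal_ideal G b"
      by (auto simp: Idc_def)
    show "\<exists>s. least (Idc G) s (Upper (Idc G) {I, J})"
      using least_Idc_join ab by blast
    show "\<exists>s. greatest (Idc G) s (Lower (Idc G) {I, J})"
      using greatest_Idc_meet ab by blast
  qed
qed

lemma Idc_join:
  assumes "a \<in> G" "b \<in> G"
  shows "principal_ideal G a \<squnion>\<^bsub>Idc G\<^esub> principal_ideal G b = principal_ideal G (sup (labs a) (labs b))"
proof -
  interpret lattice "Idc G" by (rule lattice_Idc)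
  show ?thesis
    unfolding join_def Lattice.sup_def
    by (rule some_equality) (use least_Idc_join[OF assms] least_unique in blast)+
qed

lemma Idc_meet:
  assumes "I \<in> carrier (Idc G)" "J \<in> carrier (Idc G)"
  shows "I \<sqinter>\<^bsub>Idc G\<^esub> J = I \<inter> J"
proof -
  interpret lattice "Idc G" by (rule lattice_Idc)
  obtain a b where ab: "a \<in> G" "b \<in> G" "I = principal_ideal G a" "J = principal_ideal G b"
    using assms by (auto simp: Idc_def)
  show ?thesis
    unfolding meet_def Lattice.inf_def ab
    by (rule some_equality) (use greatest_Idc_meet[OF ab(1,2)] greatest_unique in blast)+
qed

lemma Idc_bottom: "\<bottom>\<^bsub>Idc G\<^esub> = {0}"
proof -
  have 0: "0 \<in> G"
    using G qfun.subspace_0 by (auto simp: vector_sublattice_def)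
  have "principal_ideal G 0 = {0}"
    using 0 by (auto simp: mem_principal_ideal fun_eq_iff)
  then have "{0} \<in> carrier (Idc G)"
    using 0 by (auto simp: Idc_def)
  moreover have "{0} \<subseteq> principal_ideal G a" for a
    using 0 by (auto simp: mem_principal_ideal)
  ultimately have *: "least (Idc G) {0} (carrier (Idc G))"
    by (auto simp: least_def Idc_def)
  interpret lattice "Idc G" by (rule lattice_Idc)
  show ?thesis
    unfolding bottom_def by (rule some_equality) (use * least_unique in blast)+
qed

lemma Idc_distrib:
  assumes "I \<in> carrier (Idc G)" "J \<in> carrier (Idc G)" "K \<in> carrier (Idc G)"
  shows "I \<sqinter>\<^bsub>Idc G\<^esub> (J \<squnion>\<^bsub>Idc G\<^esub> K) = (I \<sqinter>\<^bsub>Idc G\<^esub> J) \<squnion>\<^bsub>Idc G\<^esub> (I \<sqinter>\<^bsub>Idc G\<^esub> K)"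
proof -
  obtain a b c where abc: "a \<in> G" "b \<in> G" "c \<in> G"
    "I = principal_ideal G a" "J = principal_ideal G b" "K = principal_ideal G c"
    using assms by (auto simp: Idc_def)
  have closed: "sup (labs x) (labs y) \<in> G" "inf (labs x) (labs y) \<in> G" if "x \<in> G" "y \<in> G" for x y
    using G that labs_closed by (auto simp: vector_sublattice_def)
  have meet: "principal_ideal G x \<sqinter>\<^bsub>Idc G\<^esub> principal_ideal G y
      = principal_ideal G (inf (labs x) (labs y))" if "x \<in> G" "y \<in> G" for x y
    using that by (subst Idc_meet) (simp_all add: principal_ideal_inf Idc_def)
  have "inf (labs a) (labs (sup (labs b) (labs c)))
      = sup (labs (inf (labs a) (labs b))) (labs (inf (labs a) (labs c)))"
    by (auto simp: fun_eq_iff labs_apply sup_rat_def inf_rat_def min_def max_def)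
  then show ?thesis
    by (simp add: abc closed meet Idc_join)
qed

end


section \<open>The vector lattice \<open>G\<close>\<close>

typedef Omega = "{u :: omega1 \<Rightarrow> rat.
    (\<forall>\<alpha>. 0 \<le> u \<alpha> \<and> u \<alpha> \<le> 1) \<and> (\<forall>\<gamma> \<beta>. 0 < \<gamma> \<and> \<gamma> < \<beta> \<longrightarrow> u \<gamma> \<le> 2 * u \<beta>)}"
  morphisms coord Abs_Omega
  by (rule exI[of _ "\<lambda>_. 0"]) simp

definition proj :: "omega1 \<Rightarrow> Omega \<Rightarrow> rat" where
  "proj \<alpha> = (\<lambda>u. coord u \<alpha>)"

definition proj_omega1 :: "Omega \<Rightarrow> rat" where
  "proj_omega1 = (\<lambda>u. 1)"

definition G :: "(Omega \<Rightarrow> rat) set" where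
  "G = generated_vector_sublattice (range proj \<union> {proj_omega1})"

end

theory Submission
  imports Defs
begin

text \<open>
  Every element of \<open>G\<close> depends on finitely many coordinates, and along a two-parameter
  family of step-shaped points of \<open>\<Omega>\<close> it restricts to one of countably many functions \<open>f x y\<close>.
  For a deviation, a pressing-down argument provides \<open>\<alpha> < \<beta>\<close> for which
  representatives \<open>c\<^sub>\<alpha>\<close>, \<open>c\<^sub>\<beta>\<close> of \<open>\<langle>p\<^sub>0\<rangle> \<setminus> \<langle>p\<^sub>\<alpha>\<rangle>\<close>, \<open>\<langle>p\<^sub>0\<rangle> \<setminus> \<langle>p\<^sub>\<beta>\<rangle>\<close> have the same
  restriction \<open>f\<close>, and such that the values \<open>f x y\<close> and \<open>f x z\<close> are attained by \<open>c\<^sub>\<alpha>\<close> and \<open>c\<^sub>\<beta>\<close>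
  at one and the same point as soon as \<open>y \<le> 2 z\<close>. Now \<open>f x y\<close> vanishes when \<open>y\<close> is large
  compared with \<open>x\<close> and does not when \<open>y\<close> is small, so along \<open>y = 1, 1/2, 1/4, \<dots>\<close> there is
  a first change, and there \<open>c\<^sub>\<alpha>\<close> vanishes but \<open>c\<^sub>\<beta>\<close> does not. The other
  non-inclusion is obtained in the same way.
\<close>

section \<open>Countable ordinals\<close>

text \<open>The closed initial segments ending at elements of \<open>A\<close> are countable, so
  their union is a countable subset of an uncountable type. Any ordinal outside the union lies
  strictly above all of \<open>A\<close>.\<close>

lemma omega1_countable_bounded:
  fixes A :: "omega1 set"
  assumes "countable A"
  shows "\<exists>\<beta>. \<forall>\<alpha>\<in>A. \<alpha> < \<beta>"
proof -
  have "countable {..\<alpha>}" for \<alpha> :: omega1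
    using countable_below_omega1[of \<alpha>]
    by (simp flip: ivl_disj_un_singleton(2))
  then have "countable (\<Union>\<alpha>\<in>A. {..\<alpha>})"
    using assms by blast
  then have "(\<Union>\<alpha>\<in>A. {..\<alpha>}) \<noteq> UNIV"
    using uncountable_omega1 by metis
  then obtain \<beta> where "\<And>\<alpha>. \<alpha> \<in> A \<Longrightarrow> \<beta> \<notin> {..\<alpha>}"
    by blast
  then show ?thesis
    by (meson atMost_iff not_le)
qed

text \<open>A weak form of Fodor's lemma: otherwise one could climb along an \<open>\<omega>\<close>-sequence to a limit
  ordinal \<open>\<alpha>\<close> in which \<open>F \<alpha>\<close> is cofinal.\<close>

lemma omega1_pressing_down:
  fixes F :: "omega1 \<Rightarrow> omega1 set"
  assumes fin: "\<And>\<alpha>. finite (F \<alpha>)"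
  shows "\<exists>l>0. uncountable {\<alpha>. l \<le> \<alpha> \<and> F \<alpha> \<inter> {l..<\<alpha>} = {}}"
proof (rule ccontr)
  assume "\<not> ?thesis"
  then have "\<exists>b. \<forall>\<alpha>. l \<le> \<alpha> \<and> F \<alpha> \<inter> {l..<\<alpha>} = {} \<longrightarrow> \<alpha> < b" if "0 < l" for l
    using omega1_countable_bounded[of "{\<alpha>. l \<le> \<alpha> \<and> F \<alpha> \<inter> {l..<\<alpha>} = {}}"] that by blast
  then obtain b where b: "\<And>l \<alpha>. 0 < l \<Longrightarrow> l \<le> \<alpha> \<Longrightarrow> F \<alpha> \<inter> {l..<\<alpha>} = {} \<Longrightarrow> \<alpha> < b l"
    by metis
  have "\<exists>l'. l < l' \<and> b l < l'" for l
    using omega1_countable_bounded[of "{l, b l}"] by auto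
  then obtain s where s: "\<And>l. l < s l" "\<And>l. b l < s l"
    by metis
  \<comment> \<open>The iteration starts with \<open>Suc k\<close> rather than \<open>k\<close>
    steps, so that every \<open>L k\<close> is positive and \<open>b\<close> applies to it.\<close>
  define L where "L k = (s ^^ Suc k) 0" for k
  have L_Suc: "L (Suc k) = s (L k)" for k
    by (simp add: L_def)
  have L_pos: "0 < L k" for k
    using s(1) omega1_zero_le by (simp add: L_def) (meson le_less_trans)
  define \<alpha> where "\<alpha> = (LEAST \<alpha>. \<forall>k. L k \<le> \<alpha>)"
  have "\<exists>\<alpha>. \<forall>k. L k \<le> \<alpha>"
    using omega1_countable_bounded[of "range L"] by (auto intro: less_imp_le)
  then have up: "L k \<le> \<alpha>" for k
    unfolding \<alpha>_def by (rule LeastI2_ex) simp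
  \<comment> \<open>Otherwise \<open>\<alpha> < b (L k) < L (Suc k) \<le> \<alpha>\<close>.\<close>
  have meets: "F \<alpha> \<inter> {L k..<\<alpha>} \<noteq> {}" for k
  proof
    assume "F \<alpha> \<inter> {L k..<\<alpha>} = {}"
    then have "\<alpha> < b (L k)"
      by (rule b[OF L_pos up])
    then show False
      using s(2)[of "L k"] up[of "Suc k"] by (simp add: L_Suc)
  qed
  \<comment> \<open>As \<open>F \<alpha>\<close> is finite, its part below \<alpha> has a greatest
    element. By \<open>meets\<close> this element bounds the whole sequence, against the leastness
    of \<alpha>.\<close>
  define m where "m = Max (F \<alpha> \<inter> {..<\<alpha>})"
  have ne: "F \<alpha> \<inter> {..<\<alpha>} \<noteq> {}"
    using meets[of 0] by auto
  have "m < \<alpha>"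
    using Max_in[of "F \<alpha> \<inter> {..<\<alpha>}"] ne fin by (simp add: m_def)
  moreover have "L k \<le> m" for k
  proof -
    obtain \<xi> where "\<xi> \<in> F \<alpha>" "L k \<le> \<xi>" "\<xi> < \<alpha>"
      using meets[of k] by auto
    then show ?thesis
      using Max_ge[of "F \<alpha> \<inter> {..<\<alpha>}" \<xi>] fin by (auto simp: m_def intro: order_trans)
  qed
  ultimately show False
    unfolding \<alpha>_def using not_less_Least[of m "\<lambda>\<alpha>. \<forall>k. L k \<le> \<alpha>"] by blast
qed

lemma uncountable_monochromatic:
  assumes "uncountable A" "countable (f ` A)"
  shows "\<exists>c. uncountable {a \<in> A. f a = c}"
proof (rule ccontr)
  assume "\<not> ?thesis"
  then have "countable (\<Union>c\<in>f ` A. {a \<in> A. f a = c})"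
    using assms(2) by blast
  moreover have "(\<Union>c\<in>f ` A. {a \<in> A. f a = c}) = A"
    by auto
  ultimately show False
    using assms(1) by simp
qed


section \<open>Generated vector sublattices\<close>

lemma vector_sublatticeI:
  assumes "0 \<in> V" "\<And>f g. f \<in> V \<Longrightarrow> g \<in> V \<Longrightarrow> f + g \<in> V" "\<And>q f. f \<in> V \<Longrightarrow> qscale q f \<in> V"
    and "\<And>f g. f \<in> V \<Longrightarrow> g \<in> V \<Longrightarrow> sup f g \<in> V" "\<And>f g. f \<in> V \<Longrightarrow> g \<in> V \<Longrightarrow> inf f g \<in> V"
  shows "vector_sublattice V"
  using assms by (simp add: vector_sublattice_def qfun.subspace_def)

lemma vector_sublatticeD:
  assumes "vector_sublattice V"
  shows "0 \<in> V" "\<And>f g. f \<in> V \<Longrightarrow> g \<in> V \<Longrightarrow> f + g \<in> V" "\<And>q f. f \<in> V \<Longrightarrow> qscale q f \<in> V"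
    and "\<And>f g. f \<in> V \<Longrightarrow> g \<in> V \<Longrightarrow> sup f g \<in> V" "\<And>f g. f \<in> V \<Longrightarrow> g \<in> V \<Longrightarrow> inf f g \<in> V"
  using assms by (simp_all add: vector_sublattice_def qfun.subspace_def)

lemma generated_vector_sublattice_minimal:
  "S \<subseteq> V \<Longrightarrow> vector_sublattice V \<Longrightarrow> generated_vector_sublattice S \<subseteq> V"
  unfolding generated_vector_sublattice_def by (rule hull_minimal)

lemma generated_vector_sublattice_superset: "S \<subseteq> generated_vector_sublattice S"
  unfolding generated_vector_sublattice_def by (rule hull_subset)

text \<open>Precomposition commutes with all pointwise operations. Hence a claim about the
  restrictions of all elements of \<open>G\<close> along a map need only be checked on the
  generators.\<close>

lemma vector_sublattice_vimage_comp:
  assumes "vector_sublattice V"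
  shows "vector_sublattice {f. f \<circ> w \<in> V}"
proof -
  have "(0 :: _ \<Rightarrow> rat) \<circ> w = 0" "(f + g) \<circ> w = (f \<circ> w) + (g \<circ> w)" "qscale q f \<circ> w = qscale q (f \<circ> w)"
    "sup f g \<circ> w = sup (f \<circ> w) (g \<circ> w)" "inf f g \<circ> w = inf (f \<circ> w) (g \<circ> w)"
    for f g :: "_ \<Rightarrow> rat" and q
    by (auto simp: fun_eq_iff qscale_def)
  then show ?thesis
    using vector_sublatticeD[OF assms] by (intro vector_sublatticeI) simp_all
qed

lemma vector_sublattice_bounded:
  "vector_sublattice {f :: 'x \<Rightarrow> rat. \<exists>b. \<forall>u. \<bar>f u\<bar> \<le> b}"
proof (rule vector_sublatticeI; clarsimp)
  show "\<exists>b. 0 \<le> (b :: rat)" by blast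
  fix f g :: "'x \<Rightarrow> rat" and b c
  assume f: "\<forall>u. \<bar>f u\<bar> \<le> b" and g: "\<forall>u. \<bar>g u\<bar> \<le> c"
  have "\<bar>f u + g u\<bar> \<le> b + c" "\<bar>sup (f u) (g u)\<bar> \<le> max b c" "\<bar>inf (f u) (g u)\<bar> \<le> max b c" for u
    using f[rule_format, of u] g[rule_format, of u] by (auto simp: sup_rat_def inf_rat_def)
  then show "\<exists>b. \<forall>u. \<bar>f u + g u\<bar> \<le> b" "\<exists>b. \<forall>u. \<bar>sup (f u) (g u)\<bar> \<le> b"
    "\<exists>b. \<forall>u. \<bar>inf (f u) (g u)\<bar> \<le> b"
    by blast+
next
  fix q b :: rat and f :: "'x \<Rightarrow> rat"
  assume "\<forall>u. \<bar>f u\<bar> \<le> b"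
  then have "\<bar>qscale q f u\<bar> \<le> \<bar>q\<bar> * b" for u
    by (simp add: qscale_def abs_mult mult_left_mono)
  then show "\<exists>b. \<forall>u. \<bar>qscale q f u\<bar> \<le> b"
    by blast
qed

section \<open>Countability via formal vector lattice terms\<close>

datatype vl_term = Var nat | Zero | Add vl_term vl_term | Scale rat vl_term
  | Sup vl_term vl_term | Inf vl_term vl_term

instance vl_term :: countable
  by countable_datatype

primrec vl_eval :: "(nat \<Rightarrow> 'x \<Rightarrow> rat) \<Rightarrow> vl_term \<Rightarrow> 'x \<Rightarrow> rat" where
  "vl_eval s (Var i) = s i"
| "vl_eval s Zero = 0"
| "vl_eval s (Add t t') = vl_eval s t + vl_eval s t'"
| "vl_eval s (Scale q t) = qscale q (vl_eval s t)"
| "vl_eval s (Sup t t') = sup (vl_eval s t) (vl_eval s t')"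
| "vl_eval s (Inf t t') = inf (vl_eval s t) (vl_eval s t')"

text \<open>The values of the terms in an enumeration of \<open>S\<close> form a vector sublattice
  containing \<open>S\<close>, and there are only countably many terms because the scalars are
  rational.\<close>

lemma countable_generated_vector_sublattice:
  assumes "countable S"
  shows "countable (generated_vector_sublattice S)"
proof -
  obtain s where s: "S \<subseteq> range (s :: nat \<Rightarrow> _)"
    using subset_range_from_nat_into[OF assms] by blast
  have "s i \<in> range (vl_eval s)" for i
    using rangeI[of "vl_eval s" "Var i"] by simp
  with s have "S \<subseteq> range (vl_eval s)"
    by blast
  moreover have "vector_sublattice (range (vl_eval s))"
  proof (rule vector_sublatticeI)
    show "0 \<in> range (vl_eval s)"
      using rangeI[of "vl_eval s" Zero] by simp
  next
    fix f g q assume "f \<in> range (vl_eval s)"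
    then obtain t where t: "f = vl_eval s t"
      by blast
    show "qscale q f \<in> range (vl_eval s)"
      using rangeI[of "vl_eval s" "Scale q t"] by (simp add: t)
    assume "g \<in> range (vl_eval s)"
    then obtain t' where t': "g = vl_eval s t'"
      by blast
    show "f + g \<in> range (vl_eval s)" "sup f g \<in> range (vl_eval s)" "inf f g \<in> range (vl_eval s)"
      using rangeI[of "vl_eval s" "Add t t'"] rangeI[of "vl_eval s" "Sup t t'"]
        rangeI[of "vl_eval s" "Inf t t'"] by (simp_all add: t t')
  qed
  ultimately have "generated_vector_sublattice S \<subseteq> range (vl_eval s)"
    by (rule generated_vector_sublattice_minimal)
  then show ?thesis
    by (rule countable_subset) simp
qed


section \<open>Deviations on principal ideals\<close>

text \<open>The bound is the first axiom of a deviation read on generators: where \<open>c\<close>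
  vanishes, \<open>a\<close> is dominated by a fixed multiple of \<open>b\<close>.\<close>

lemma deviation_representatives:
  assumes V: "vector_sublattice V" and D: "deviation (Idc V) D" and ab: "a \<in> V" "b \<in> V"
  shows "\<exists>c n. c \<in> V \<and> D (principal_ideal V a) (principal_ideal V b) = principal_ideal V c \<and>
    (\<forall>u. \<bar>a u\<bar> \<le> of_nat n * max \<bar>b u\<bar> \<bar>c u\<bar>)"
proof -
  let ?a = "principal_ideal V a" and ?b = "principal_ideal V b"
  have car: "?a \<in> carrier (Idc V)" "?b \<in> carrier (Idc V)"
    using ab by (auto simp: Idc_def)
  then have "D ?a ?b \<in> carrier (Idc V)"
    using D by (auto simp: deviation_def)
  then obtain c where c: "c \<in> V" "D ?a ?b = principal_ideal V c"
    by (auto simp: Idc_def)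
  have "?a \<sqsubseteq>\<^bsub>Idc V\<^esub> ?b \<squnion>\<^bsub>Idc V\<^esub> D ?a ?b"
    using D car by (simp add: deviation_def)
  then have "?a \<subseteq> principal_ideal V (sup (labs b) (labs c))"
    using Idc_join[OF V ab(2) c(1)] by (simp add: c(2) Idc_def)
  then obtain n :: nat where "\<forall>u. \<bar>a u\<bar> \<le> of_nat n * \<bar>sup (labs b) (labs c) u\<bar>"
    using principal_ideal_subset_iff[OF V ab(1)] by blast
  moreover have "\<bar>sup (labs b) (labs c) u\<bar> = max \<bar>b u\<bar> \<bar>c u\<bar>" for u
    by (simp add: labs_apply[OF V] sup_rat_def)
  ultimately show ?thesis
    using c by metis
qed

text \<open>The meet of the two ideals is generated by the infimum of the absolute values of
  \<open>c\<close> and \<open>d\<close>. This generator belongs to the ideal, which is zero by the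
  second axiom.\<close>

lemma deviation_disjoint:
  assumes V: "vector_sublattice V" and D: "deviation (Idc V) D" and ab: "a \<in> V" "b \<in> V"
    and c: "c \<in> V" "D (principal_ideal V a) (principal_ideal V b) = principal_ideal V c"
    and d: "d \<in> V" "D (principal_ideal V b) (principal_ideal V a) = principal_ideal V d"
  shows "c u = 0 \<or> d u = 0"
proof -
  let ?m = "inf (labs c) (labs d)"
  have car: "principal_ideal V x \<in> carrier (Idc V)" if "x \<in> V" for x
    using that by (auto simp: Idc_def)
  have "principal_ideal V c \<sqinter>\<^bsub>Idc V\<^esub> principal_ideal V d = \<bottom>\<^bsub>Idc V\<^esub>"
    using D car ab c(2) d(2) unfolding deviation_def by metis
  then have "principal_ideal V ?m = {0}"
    using Idc_meet[OF V car car] Idc_bottom[OF V] principal_ideal_inf[OF V] c(1) d(1) by simp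
  moreover have "?m \<in> V"
    using vector_sublatticeD(5)[OF V labs_closed[OF V c(1)] labs_closed[OF V d(1)]] .
  then have "?m \<in> principal_ideal V ?m"
    by (simp add: mem_principal_ideal[OF V] exI[of _ 1] del: inf_apply)
  ultimately have "?m u = 0"
    by simp
  then show ?thesis
    by (simp add: labs_apply[OF V] inf_rat_def min_def split: if_splits)
qed


section \<open>The vector lattice \<open>G\<close>\<close>

lemma vector_sublattice_G: "vector_sublattice G"
  unfolding G_def by (rule vector_sublattice_generated)

lemma proj_in_G: "proj \<alpha> \<in> G" and proj_omega1_in_G: "proj_omega1 \<in> G"
  unfolding G_def by (rule subsetD[OF generated_vector_sublattice_superset], simp)+

lemma coord_nonneg: "0 \<le> coord u \<alpha>" and coord_le_1: "coord u \<alpha> \<le> 1"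
  and coord_le_twice: "0 < \<alpha> \<Longrightarrow> \<alpha> < \<beta> \<Longrightarrow> coord u \<alpha> \<le> 2 * coord u \<beta>"
  using coord[of u] by blast+

lemma principal_ideal_proj_mono:
  assumes "0 < \<alpha>" "\<alpha> < \<beta>"
  shows "principal_ideal G (proj \<alpha>) \<subseteq> principal_ideal G (proj \<beta>)"
proof -
  have "\<bar>proj \<alpha> u\<bar> \<le> of_nat 2 * \<bar>proj \<beta> u\<bar>" for u
    using coord_le_twice[OF assms, of u] by (simp add: proj_def coord_nonneg)
  then show ?thesis
    unfolding principal_ideal_subset_iff[OF vector_sublattice_G proj_in_G] by blast
qed

lemma archimedean_G: "archimedean G"
  unfolding archimedean_def
proof (intro ballI impI)
  fix a b :: "Omega \<Rightarrow> rat"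
  assume *: "\<forall>n::nat. qscale (of_nat n) a \<le> b"
  have "a u \<le> 0" for u
  proof (rule ccontr)
    assume "\<not> a u \<le> 0"
    then obtain n :: nat where "b u < of_nat n * a u"
      using ex_less_of_nat_mult[of "a u" "b u"] by auto
    with * show False
      by (auto simp: le_fun_def qscale_def not_le[symmetric])
  qed
  then show "a \<le> 0"
    by (simp add: le_fun_def)
qed

lemma strong_unit_G: "strong_unit G proj_omega1"
proof -
  have "G \<subseteq> {f. \<exists>b. \<forall>u. \<bar>f u\<bar> \<le> b}"
    unfolding G_def
    by (rule generated_vector_sublattice_minimal[OF _ vector_sublattice_bounded])
      (auto simp: proj_def proj_omega1_def coord_nonneg coord_le_1 intro!: exI[of _ 1])
  moreover have "\<exists>n::nat. a \<le> qscale (of_nat n) proj_omega1" if "\<forall>u. \<bar>a u\<bar> \<le> b" for a b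
  proof -
    obtain n :: nat where "b \<le> of_nat n"
      using reals_Archimedean2[of b] less_imp_le by blast
    then have "a u \<le> of_nat n" for u
      using that[rule_format, of u] by linarith
    then show ?thesis
      by (auto simp: le_fun_def qscale_def proj_omega1_def)
  qed
  ultimately show ?thesis
    using proj_omega1_in_G by (auto simp: strong_unit_def le_fun_def proj_omega1_def)
qed

definition determined_on :: "omega1 set \<Rightarrow> (Omega \<Rightarrow> rat) \<Rightarrow> bool" where
  "determined_on F f \<longleftrightarrow> (\<forall>u v. (\<forall>\<xi>\<in>F. coord u \<xi> = coord v \<xi>) \<longrightarrow> f u = f v)"

lemma G_finitely_determined:
  assumes "f \<in> G"
  shows "\<exists>F. finite F \<and> determined_on F f"
proof -
  let ?V = "{f. \<exists>F. finite F \<and> determined_on F f}"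
  \<comment> \<open>With an arbitrary \<open>h\<close>, the union of the two finite supports settles
    sum, join and meet at once, and scaling too, by an \<open>h\<close> that ignores its second
    argument.\<close>
  have bin: "(\<lambda>u. h (f u) (g u)) \<in> ?V" if fg: "f \<in> ?V" "g \<in> ?V" for f g and h :: "rat \<Rightarrow> rat \<Rightarrow> rat"
  proof -
    obtain E F where "finite E" "determined_on E f" "finite F" "determined_on F g"
      using fg by blast
    then have "finite (E \<union> F)" "determined_on (E \<union> F) (\<lambda>u. h (f u) (g u))"
      by (auto simp: determined_on_def) (metis (no_types, lifting) UnCI)
    then show ?thesis
      by blast
  qed
  have "vector_sublattice ?V"
  proof (rule vector_sublatticeI)
    show "0 \<in> ?V"
      by (auto simp: determined_on_def)
  next
    fix f g q assume f: "f \<in> ?V"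
    show "qscale q f \<in> ?V"
      using bin[OF f f, of "\<lambda>a b. q * a"] by (simp add: qscale_def)
    assume g: "g \<in> ?V"
    show "f + g \<in> ?V" "sup f g \<in> ?V" "inf f g \<in> ?V"
      using bin[OF f g, of "(+)"] bin[OF f g, of sup] bin[OF f g, of inf]
      by (simp_all add: plus_fun_def sup_fun_def inf_fun_def)
  qed
  moreover have "range proj \<union> {proj_omega1} \<subseteq> ?V"
    by (auto simp: determined_on_def proj_def proj_omega1_def intro: exI[of _ "{_}"])
  ultimately have "G \<subseteq> ?V"
    unfolding G_def by (intro generated_vector_sublattice_minimal)
  with assms show ?thesis
    by blast
qed


section \<open>Step-shaped points of \<open>\<Omega>\<close>\<close>

text \<open>Coordinate 0 is exempt from the constraint on \<open>Omega\<close>. Elsewhere only a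
  drop can violate it, so the passage from \<open>y\<close> to \<open>z\<close> is the critical one,
  and it may halve the value.\<close>

definition step :: "omega1 \<Rightarrow> omega1 \<Rightarrow> rat \<Rightarrow> rat \<Rightarrow> rat \<Rightarrow> Omega" where
  "step l m x y z =
     Abs_Omega (\<lambda>\<xi>. if \<xi> = 0 then x else if \<xi> < l then 0 else if \<xi> < m then y else z)"

lemma coord_step:
  assumes "0 \<le> x" "x \<le> 1" "0 \<le> y" "y \<le> 1" "0 \<le> z" "z \<le> 1" "y \<le> 2 * z"
  shows "coord (step l m x y z) \<xi> =
    (if \<xi> = 0 then x else if \<xi> < l then 0 else if \<xi> < m then y else z)"
proof -
  have "(\<lambda>\<xi>. if \<xi> = 0 then x else if \<xi> < l then 0 else if \<xi> < m then y else z) \<in>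
    {u. (\<forall>\<alpha>. 0 \<le> u \<alpha> \<and> u \<alpha> \<le> 1) \<and> (\<forall>\<gamma> \<beta>. 0 < \<gamma> \<and> \<gamma> < \<beta> \<longrightarrow> u \<gamma> \<le> 2 * u \<beta>)}"
    using assms by auto
  then show ?thesis
    unfolding step_def by (subst Abs_Omega_inverse) auto
qed

text \<open>Truncation makes restrictions along \<open>corner\<close> functions on all pairs of
  rationals, free of side conditions.\<close>

definition clip :: "rat \<Rightarrow> rat" where
  "clip x = max 0 (min 1 x)"

lemma clip: "0 \<le> clip x" "clip x \<le> 1" "0 \<le> x \<Longrightarrow> x \<le> 1 \<Longrightarrow> clip x = x"
  by (auto simp: clip_def)

definition corner :: "omega1 \<Rightarrow> rat \<times> rat \<Rightarrow> Omega" where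
  "corner l = (\<lambda>(x, y). step l l (clip x) (clip y) (clip y))"

lemma coord_corner:
  "coord (corner l (x, y)) \<xi> = (if \<xi> = 0 then clip x else if \<xi> < l then 0 else clip y)"
  unfolding corner_def using clip(1)[of y] by (simp add: coord_step clip)

text \<open>The projections have at most three different restrictions, according to whether the
  index is 0, below \<open>l\<close> or beyond. With the constant 1, at most four functions generate
  a lattice containing all restrictions.\<close>

lemma countable_corner_restrictions: "countable ((\<lambda>f. f \<circ> corner l) ` G)"
proof -
  let ?S = "{\<lambda>(x, y). clip x, \<lambda>(x, y). clip y, 0, \<lambda>_. 1}"
  have "range proj \<union> {proj_omega1} \<subseteq> {f. f \<circ> corner l \<in> generated_vector_sublattice ?S}"
  proof -
    have "f \<circ> corner l \<in> ?S" if f: "f \<in> range proj \<union> {proj_omega1}" for f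
    proof (cases "f = proj_omega1")
      case False
      with f obtain \<xi> where "f = proj \<xi>"
        by auto
      then have "f \<circ> corner l = (\<lambda>(x, y). if \<xi> = 0 then clip x else if \<xi> < l then 0 else clip y)"
        by (auto simp: proj_def coord_corner fun_eq_iff)
      then show ?thesis
        by (auto simp: fun_eq_iff)
    qed (auto simp: proj_omega1_def fun_eq_iff)
    then show ?thesis
      using generated_vector_sublattice_superset[of ?S] by blast
  qed
  then have "G \<subseteq> {f. f \<circ> corner l \<in> generated_vector_sublattice ?S}"
    unfolding G_def
    by (intro generated_vector_sublattice_minimal vector_sublattice_vimage_comp
        vector_sublattice_generated)
  then have "(\<lambda>f. f \<circ> corner l) ` G \<subseteq> generated_vector_sublattice ?S"
    by blast
  then show ?thesis
    by (rule countable_subset) (simp add: countable_generated_vector_sublattice)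
qed

section \<open>Pairs of indices with a common restriction\<close>

lemma similar_pair:
  fixes h :: "omega1 \<Rightarrow> Omega \<Rightarrow> rat" and N :: "omega1 \<Rightarrow> nat"
  assumes h: "\<And>\<alpha>. h \<alpha> \<in> G"
  shows "\<exists>f \<alpha> \<beta>. 0 < \<alpha> \<and> \<alpha> < \<beta> \<and> N \<alpha> = N \<beta> \<and>
    (\<forall>x y z. 0 \<le> x \<and> x \<le> 1 \<and> 0 \<le> y \<and> y \<le> 1 \<and> 0 \<le> z \<and> z \<le> 1 \<and> y \<le> 2 * z \<longrightarrow>
      (\<exists>u. coord u 0 = x \<and> coord u \<alpha> = y \<and> coord u \<beta> = z \<and> h \<alpha> u = f x y \<and> h \<beta> u = f x z))"
proof -
  obtain F where F: "\<And>\<alpha>. finite (F \<alpha>)" "\<And>\<alpha>. determined_on (F \<alpha>) (h \<alpha>)"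
    using G_finitely_determined[OF h] by metis
  obtain l where l: "0 < l" "uncountable {\<alpha>. l \<le> \<alpha> \<and> F \<alpha> \<inter> {l..<\<alpha>} = {}}"
    using omega1_pressing_down[of F, OF F(1)] by blast
  let ?A = "{\<alpha>. l \<le> \<alpha> \<and> F \<alpha> \<inter> {l..<\<alpha>} = {}}"
  let ?color = "\<lambda>\<alpha>. (N \<alpha>, h \<alpha> \<circ> corner l)"
  have "?color ` ?A \<subseteq> UNIV \<times> (\<lambda>f. f \<circ> corner l) ` G"
    using h by auto
  then have "countable (?color ` ?A)"
    by (rule countable_subset) (simp add: countable_corner_restrictions)
  from uncountable_monochromatic[OF l(2) this]
  obtain n f where nf: "uncountable {\<alpha> \<in> ?A. ?color \<alpha> = (n, f)}"
    by auto
  have unbounded: "\<exists>\<beta>. l \<le> \<beta> \<and> F \<beta> \<inter> {l..<\<beta>} = {} \<and> N \<beta> = n \<and> h \<beta> \<circ> corner l = f \<and> b \<le> \<beta>" for b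
  proof (rule ccontr)
    assume "\<not> ?thesis"
    then have "{\<alpha> \<in> ?A. ?color \<alpha> = (n, f)} \<subseteq> {..<b}"
      by (auto simp: not_le)
    then have "countable {\<alpha> \<in> ?A. ?color \<alpha> = (n, f)}"
      by (rule countable_subset[OF _ countable_below_omega1])
    with nf show False
      by (rule notE)
  qed
  obtain \<alpha> where \<alpha>: "l \<le> \<alpha>" "N \<alpha> = n" "h \<alpha> \<circ> corner l = f"
    using unbounded[of 0] by blast
  \<comment> \<open>Placing \<beta> beyond \<alpha> and all of \<open>F \<alpha>\<close> makes
    \<open>h \<alpha>\<close> independent of the coordinates from \<beta> on.\<close>
  obtain b where b: "\<And>\<xi>. \<xi> \<in> insert \<alpha> (F \<alpha>) \<Longrightarrow> \<xi> < b"
    using omega1_countable_bounded[of "insert \<alpha> (F \<alpha>)"] F(1)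
    by (metis countable_finite finite_insert)
  obtain \<beta> where \<beta>: "l \<le> \<beta>" "F \<beta> \<inter> {l..<\<beta>} = {}" "N \<beta> = n" "h \<beta> \<circ> corner l = f" "b \<le> \<beta>"
    using unbounded[of b] by blast
  have pos: "0 < \<alpha>" "\<alpha> < \<beta>"
    using l(1) \<alpha>(1) b[of \<alpha>] \<beta>(5) by auto
  have "\<exists>u. coord u 0 = x \<and> coord u \<alpha> = y \<and> coord u \<beta> = z \<and> h \<alpha> u = f (x, y) \<and> h \<beta> u = f (x, z)"
    if xyz: "0 \<le> x" "x \<le> 1" "0 \<le> y" "y \<le> 1" "0 \<le> z" "z \<le> 1" "y \<le> 2 * z" for x y z
  proof -
    \<comment> \<open>The change from \<open>y\<close> to \<open>z\<close> sits at \<beta>. Since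
      \<open>F \<alpha>\<close> lies below \<beta>, \<open>h \<alpha>\<close> does not see
      \<open>z\<close>; since \<open>F \<beta>\<close> avoids the interval from \<open>l\<close> to
      \<beta>, \<open>h \<beta>\<close> does not see \<open>y\<close>.\<close>
    let ?u = "step l \<beta> x y z"
    note c = coord_step[OF xyz]
    have "h \<alpha> ?u = h \<alpha> (corner l (x, y))"
    proof -
      have "coord ?u \<xi> = coord (corner l (x, y)) \<xi>" if "\<xi> \<in> F \<alpha>" for \<xi>
        using b[of \<xi>] that \<beta>(5) by (auto simp: c coord_corner clip(3) xyz)
      then show ?thesis
        using F(2)[of \<alpha>] by (simp add: determined_on_def)
    qed
    moreover have "h \<beta> ?u = h \<beta> (corner l (x, z))"
    proof -
      have "coord ?u \<xi> = coord (corner l (x, z)) \<xi>" if "\<xi> \<in> F \<beta>" for \<xi>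
        using \<beta>(2) that by (auto simp: c coord_corner clip(3) xyz)
      then show ?thesis
        using F(2)[of \<beta>] by (simp add: determined_on_def)
    qed
    ultimately show ?thesis
      using pos l(1) \<alpha> \<beta> by (intro exI[of _ ?u]) (auto simp: c fun_eq_iff)
  qed
  then show ?thesis
    using pos \<alpha>(2) \<beta>(3) by (intro exI[of _ "\<lambda>x y. f (x, y)"] exI[of _ \<alpha>] exI[of _ \<beta>]) auto
qed

text \<open>Leaving \<open>Q\<close> open lets one argument serve both non-inclusions: it will be
  vanishing for one family of representatives and non-vanishing for the other.\<close>

lemma exists_switch:
  assumes h: "\<And>\<alpha>. h \<alpha> \<in> G"
    and large: "\<And>\<alpha> u. 0 < \<alpha> \<Longrightarrow> of_nat (N \<alpha>) * coord u 0 < coord u \<alpha> \<Longrightarrow> Q (h \<alpha> u)"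
    and small: "\<And>\<alpha> u. 0 < \<alpha> \<Longrightarrow> of_nat (N \<alpha>) * coord u \<alpha> < coord u 0 \<Longrightarrow> \<not> Q (h \<alpha> u)"
  shows "\<exists>\<alpha> \<beta> u. 0 < \<alpha> \<and> \<alpha> < \<beta> \<and> Q (h \<alpha> u) \<and> \<not> Q (h \<beta> u)"
proof -
  obtain f \<alpha> \<beta> where ab: "0 < \<alpha>" "\<alpha> < \<beta>" "N \<alpha> = N \<beta>" and
    f: "\<And>x y z. 0 \<le> x \<Longrightarrow> x \<le> 1 \<Longrightarrow> 0 \<le> y \<Longrightarrow> y \<le> 1 \<Longrightarrow> 0 \<le> z \<Longrightarrow> z \<le> 1 \<Longrightarrow> y \<le> 2 * z \<Longrightarrow>
      \<exists>u. coord u 0 = x \<and> coord u \<alpha> = y \<and> coord u \<beta> = z \<and> h \<alpha> u = f x y \<and> h \<beta> u = f x z"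
    using similar_pair[of h N, OF h] by metis
  define n :: rat where "n = of_nat (N \<alpha>)"
  \<comment> \<open>This choice gives \<open>n * x < 1\<close>, so that \<open>large\<close> applies
    at \<open>y = 1\<close>.\<close>
  define x :: rat where "x = 1 / (2 * (n + 1))"
  have n: "0 \<le> n"
    by (simp add: n_def)
  then have x: "0 < x" "x \<le> 1" "n * x < 1"
    by (auto simp: x_def field_simps)
  have "Q (f x 1)"
  proof -
    obtain u where "coord u 0 = x" "coord u \<alpha> = 1" "h \<alpha> u = f x 1"
      using f[of x 1 1] x by auto
    then show ?thesis
      using large[OF ab(1), of u] x by (simp add: n_def)
  qed
  obtain k where k: "n * (1/2) ^ k < x"
  proof -
    obtain k where "n / x < of_nat k"
      using reals_Archimedean2 by blast
    then have "n / x < 2 ^ k"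
      using of_nat_less_two_power[of k] by (rule less_trans)
    then show ?thesis
      using x(1) by (intro that[of k]) (simp add: field_simps power_divide)
  qed
  have pow: "0 \<le> (1/2 :: rat) ^ j" "(1/2 :: rat) ^ j \<le> 1" for j :: nat
    by (simp_all add: power_le_one)
  have "\<not> Q (f x ((1/2) ^ k))"
  proof -
    obtain u where "coord u 0 = x" "coord u \<alpha> = (1/2) ^ k" "h \<alpha> u = f x ((1/2) ^ k)"
      using f[of x "(1/2) ^ k" "(1/2) ^ k"] x pow[of k] by auto
    then show ?thesis
      using small[OF ab(1), of u] k by (simp add: n_def)
  qed
  then obtain j where j: "Q (f x ((1/2) ^ j))" "\<not> Q (f x ((1/2) ^ Suc j))"
    using \<open>Q (f x 1)\<close> inc_induct[of 0 k "\<lambda>j. \<not> Q (f x ((1/2) ^ j))"] by (metis le0 power_0)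
  \<comment> \<open>Consecutive powers satisfy \<open>y = 2 * z\<close>, the extreme case that the
    constraint on \<open>Omega\<close> permits.\<close>
  obtain u where "h \<alpha> u = f x ((1/2) ^ j)" "h \<beta> u = f x ((1/2) ^ Suc j)"
    using f[of x "(1/2) ^ j" "(1/2) ^ Suc j"] x pow[of j] pow[of "Suc j"] by auto
  then show ?thesis
    using ab j by metis
qed

section \<open>The two non-inclusions\<close>

lemma deviation_not_antitone_isotone:
  assumes D: "deviation (Idc G) D"
  shows "\<exists>\<alpha> \<beta>. 0 < \<alpha> \<and> \<alpha> < \<beta> \<and>
      \<not> D (principal_ideal G (proj 0)) (principal_ideal G (proj \<beta>))
        \<subseteq> D (principal_ideal G (proj 0)) (principal_ideal G (proj \<alpha>))" (is ?A)
    and "\<exists>\<alpha> \<beta>. 0 < \<alpha> \<and> \<alpha> < \<beta> \<and>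
      \<not> D (principal_ideal G (proj \<alpha>)) (principal_ideal G (proj 0))
        \<subseteq> D (principal_ideal G (proj \<beta>)) (principal_ideal G (proj 0))" (is ?B)
proof -
  let ?p = "\<lambda>\<alpha>. principal_ideal G (proj \<alpha>)"
  obtain c n where c: "\<And>\<alpha>. c \<alpha> \<in> G" "\<And>\<alpha>. D (?p 0) (?p \<alpha>) = principal_ideal G (c \<alpha>)"
    and n: "\<And>\<alpha> u. coord u 0 \<le> of_nat (n \<alpha>) * max (coord u \<alpha>) \<bar>c \<alpha> u\<bar>"
    using deviation_representatives[OF vector_sublattice_G D proj_in_G proj_in_G, of 0]
    unfolding proj_def abs_of_nonneg[OF coord_nonneg] by metis
  obtain d m where d: "\<And>\<alpha>. d \<alpha> \<in> G" "\<And>\<alpha>. D (?p \<alpha>) (?p 0) = principal_ideal G (d \<alpha>)"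
    and m: "\<And>\<alpha> u. coord u \<alpha> \<le> of_nat (m \<alpha>) * max (coord u 0) \<bar>d \<alpha> u\<bar>"
    using deviation_representatives[OF vector_sublattice_G D proj_in_G proj_in_G, of _ 0]
    unfolding proj_def abs_of_nonneg[OF coord_nonneg] by metis
  have cd: "c \<alpha> u = 0 \<or> d \<alpha> u = 0" for \<alpha> u
    by (rule deviation_disjoint[OF vector_sublattice_G D proj_in_G proj_in_G c d])
  \<comment> \<open>The sum dominates both the constants for \<open>c\<close> and those for
    \<open>d\<close>.\<close>
  let ?N = "\<lambda>\<alpha>. n \<alpha> + m \<alpha>"
  have c_nz: "c \<alpha> u \<noteq> 0" if "of_nat (?N \<alpha>) * coord u \<alpha> < coord u 0" for \<alpha> u
  proof
    assume "c \<alpha> u = 0"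
    then have "coord u 0 \<le> of_nat (n \<alpha>) * coord u \<alpha>"
      using n[of u \<alpha>] by (simp add: coord_nonneg max_absorb1)
    also have "\<dots> \<le> of_nat (?N \<alpha>) * coord u \<alpha>"
      by (intro mult_right_mono) (simp_all add: coord_nonneg)
    finally show False
      using that by simp
  qed
  have d_nz: "d \<alpha> u \<noteq> 0" if "of_nat (?N \<alpha>) * coord u 0 < coord u \<alpha>" for \<alpha> u
  proof
    assume "d \<alpha> u = 0"
    then have "coord u \<alpha> \<le> of_nat (m \<alpha>) * coord u 0"
      using m[of u \<alpha>] by (simp add: coord_nonneg max_absorb1)
    also have "\<dots> \<le> of_nat (?N \<alpha>) * coord u 0"
      by (intro mult_right_mono) (simp_all add: coord_nonneg)
    finally show False
      using that by simp
  qed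
  have vanish: "a u = 0" if "principal_ideal G a \<subseteq> principal_ideal G b" "a \<in> G" "b u = 0" for a b u
    using that principal_ideal_subset_iff[OF vector_sublattice_G, of a b]
    by (metis abs_eq_0 abs_le_zero_iff mult_zero_right)
  \<comment> \<open>If coordinate \<alpha> is large against coordinate 0, then
    \<open>d \<alpha>\<close> is nonzero, so \<open>c \<alpha>\<close> vanishes by disjointness; if
    it is small, \<open>c \<alpha>\<close> is nonzero.\<close>
  obtain \<alpha> \<beta> u where "0 < \<alpha>" "\<alpha> < \<beta>" "c \<alpha> u = 0" "c \<beta> u \<noteq> 0"
    using exists_switch[of c ?N "\<lambda>r. r = 0", OF c(1)] c_nz d_nz cd by metis
  then show ?A
    using vanish c by metis
  \<comment> \<open>The roles are exchanged: here disjointness is used in the small case, where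
    \<open>c \<alpha>\<close> is nonzero and forces \<open>d \<alpha>\<close> to vanish.\<close>
  obtain \<alpha> \<beta> u where "0 < \<alpha>" "\<alpha> < \<beta>" "d \<alpha> u \<noteq> 0" "d \<beta> u = 0"
    using exists_switch[of d ?N "\<lambda>r. r \<noteq> 0", OF d(1)] c_nz d_nz cd by metis
  then show ?B
    using vanish d by metis
qed

theorem theorem6p8:
  shows "archimedean G \<and> (\<exists>u. strong_unit G u)
    \<and> \<not> (\<exists>d. deviation (Idc G) d \<and> (left_isotone (Idc G) d \<or> right_antitone (Idc G) d))
    \<and> (\<forall>d. deviation (Idc G) d \<longrightarrow>
      (\<exists>\<alpha> \<beta> \<alpha>' \<beta>' :: omega1. 0 < \<alpha> \<and> \<alpha> < \<beta> \<and> 0 < \<alpha>' \<and> \<alpha>' < \<beta>' \<and>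
         \<not> d (principal_ideal G (proj 0)) (principal_ideal G (proj \<beta>))
             \<sqsubseteq>\<^bsub>Idc G\<^esub> d (principal_ideal G (proj 0)) (principal_ideal G (proj \<alpha>)) \<and>
         \<not> d (principal_ideal G (proj \<alpha>')) (principal_ideal G (proj 0))
             \<sqsubseteq>\<^bsub>Idc G\<^esub> d (principal_ideal G (proj \<beta>')) (principal_ideal G (proj 0))))"
proof -
  have le: "I \<sqsubseteq>\<^bsub>Idc G\<^esub> J \<longleftrightarrow> I \<subseteq> J" for I J
    by (simp add: Idc_def)
  have car: "principal_ideal G (proj \<alpha>) \<in> carrier (Idc G)" for \<alpha>
    by (simp add: Idc_def proj_in_G)
  \<comment> \<open>For positive indices the ideals of the projections increase. So the first
    non-inclusion refutes right antitonicity and the second refutes left isotonicity.\<close>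
  have "\<not> left_isotone (Idc G) d \<and> \<not> right_antitone (Idc G) d" if D: "deviation (Idc G) d" for d
    using deviation_not_antitone_isotone[OF D] principal_ideal_proj_mono car
    unfolding left_isotone_def right_antitone_def le by meson
  moreover have "\<exists>\<alpha> \<beta> \<alpha>' \<beta>' :: omega1. 0 < \<alpha> \<and> \<alpha> < \<beta> \<and> 0 < \<alpha>' \<and> \<alpha>' < \<beta>' \<and>
         \<not> d (principal_ideal G (proj 0)) (principal_ideal G (proj \<beta>))
             \<subseteq> d (principal_ideal G (proj 0)) (principal_ideal G (proj \<alpha>)) \<and>
         \<not> d (principal_ideal G (proj \<alpha>')) (principal_ideal G (proj 0))
             \<subseteq> d (principal_ideal G (proj \<beta>')) (principal_ideal G (proj 0))"
    if D: "deviation (Idc G) d" for d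
    using deviation_not_antitone_isotone[OF D] by metis
  ultimately show ?thesis
    unfolding le using archimedean_G strong_unit_G by blast
qed

end
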